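(* Let $X$ be a real Hilbert space, $m\in\mathbb{N}$, $I:=\{1,\ldots,m\}$, and for each $i\in I$ let $T_i:X\to X$ be a cutter with fixed point set $F_i$, such that $\bigcap_{i\in I}F_i\neq\emptyset$. Let $\tau_1,\tau_2\in(0,1]$, let $x\in X$, and let $w:I\to[0,1]$ be a weight function. If $\lambda\in[\tau_1,(2-\tau_2)L(x,w)]$ and $T_{w,\lambda}(x)=x$, then $T_i(x)=x$ for all $i\in\widehat{I}_w:=\{i\in I\mid w(i)>0\}$.
   Context: An operator $T:X\to X$ on a real Hilbert space is called a cutter if $\mathrm{Fix}(T):=\{x\in X\mid T(x)=x\}\neq\emptyset$ and $\langle x-T(x),q-T(x)\rangle\le 0$ for all $x\in X$ and all $q\in\mathrm{Fix}(T)$. A weight function on $I$ is a function $w:I\to[0,1]$ with $\sum_{i\in I}w(i)=1$. Put $T_w(x):=\sum_{i\in I}w(i)T_i(x)$ and, for $\lambda\in\mathbb{R}$, $T_{w,\lambda}(x):=x+\lambda(T_w(x)-x)$. Define $L(x,w):=\dfrac{\sum_{i\in I}w(i)\|T_i(x)-x\|^2}{\|T_w(x)-x\|^2}$ if $T_w(x)\neq x$, and $L(x,w):=1$ otherwise. *)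

theory Defs
  imports "HOL-Analysis.Analysis"
begin

definition Fix :: "('a \<Rightarrow> 'a) \<Rightarrow> 'a set" where
  "Fix T = {x. T x = x}"

definition cutter :: "('a::{real_inner,complete_space} \<Rightarrow> 'a) \<Rightarrow> bool" where
  "cutter T \<longleftrightarrow> Fix T \<noteq> {} \<and> (\<forall>x. \<forall>q\<in>Fix T. (x - T x) \<bullet> (q - T x) \<le> 0)"

text \<open>A weight function on \<open>I\<close> is a total function of which only the values on \<open>I\<close> matter.
  All index sets are meant to be finite.\<close>

definition weight_function :: "'i set \<Rightarrow> ('i \<Rightarrow> real) \<Rightarrow> bool" where
  "weight_function I w \<longleftrightarrow> w \<in> I \<rightarrow> {0..1} \<and> (\<Sum>i\<in>I. w i) = 1"

definition active_indices :: "'i set \<Rightarrow> ('i \<Rightarrow> real) \<Rightarrow> 'i set" where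
  "active_indices I w = {i\<in>I. w i > 0}"

definition weighted_op ::
  "'i set \<Rightarrow> ('i \<Rightarrow> 'a \<Rightarrow> 'a) \<Rightarrow> ('i \<Rightarrow> real) \<Rightarrow> 'a \<Rightarrow> 'a::{real_inner,complete_space}" where
  "weighted_op I T w x = (\<Sum>i\<in>I. w i *\<^sub>R T i x)"

definition relaxed_op ::
  "'i set \<Rightarrow> ('i \<Rightarrow> 'a \<Rightarrow> 'a) \<Rightarrow> ('i \<Rightarrow> real) \<Rightarrow> real \<Rightarrow> 'a \<Rightarrow> 'a::{real_inner,complete_space}" where
  "relaxed_op I T w lam x = x + lam *\<^sub>R (weighted_op I T w x - x)"

definition extrapolation ::
  "'i set \<Rightarrow> ('i \<Rightarrow> 'a \<Rightarrow> 'a) \<Rightarrow> 'a::{real_inner,complete_space} \<Rightarrow> ('i \<Rightarrow> real) \<Rightarrow> real" where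
  "extrapolation I T x w =
     (if weighted_op I T w x \<noteq> x
      then (\<Sum>i\<in>I. w i * (norm (T i x - x))\<^sup>2) / (norm (weighted_op I T w x - x))\<^sup>2
      else 1)"

end

theory Submission
  imports Defs
begin

text \<open>Since \<open>lam \<ge> \<tau>\<^sub>1 > 0\<close>, a fixed point \<open>x\<close> of the relaxation is a fixed point of the
  average \<open>T\<^sub>w\<close> itself. A cutter moves \<open>x\<close> towards each of its fixed points \<open>q\<close>, with the
  quantitative bound \<open>\<parallel>T x - x\<parallel>\<^sup>2 \<le> \<langle>T x - x, q - x\<rangle>\<close>, which is linear in the displacement on the
  right. At a common fixed point \<open>q\<close> these bounds can therefore be averaged: the right-hand
  sides add up to \<open>\<langle>T\<^sub>w x - x, q - x\<rangle> = 0\<close>, so the displacements with positive weight vanish.\<close>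

text \<open>Split \<open>q - T x\<close> as \<open>(q - x) + (x - T x)\<close> in the inequality defining a cutter.\<close>

lemma cutter_displacement_bound:
  assumes "cutter T" and "q \<in> Fix T"
  shows "(norm (T x - x))\<^sup>2 \<le> (T x - x) \<bullet> (q - x)"
proof -
  have "(x - T x) \<bullet> (q - T x) \<le> 0"
    using assms unfolding cutter_def by blast
  moreover have "(x - T x) \<bullet> (q - T x) = (norm (T x - x))\<^sup>2 - (T x - x) \<bullet> (q - x)"
    by (simp add: power2_norm_eq_inner algebra_simps inner_commute)
  ultimately show ?thesis
    by simp
qed

lemma weighted_op_displacement:
  assumes "weight_function I w"
  shows "weighted_op I T w x - x = (\<Sum>i\<in>I. w i *\<^sub>R (T i x - x))"
proof -
  have "(\<Sum>i\<in>I. w i *\<^sub>R x) = x"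
    using assms by (simp add: weight_function_def flip: scaleR_left.sum)
  then show ?thesis
    by (simp add: weighted_op_def scaleR_diff_right sum_subtractf)
qed

lemma weighted_op_displacement_bound:
  assumes "weight_function I w"
    and "\<And>i. i \<in> I \<Longrightarrow> cutter (T i)" and "q \<in> (\<Inter>i\<in>I. Fix (T i))"
  shows "(\<Sum>i\<in>I. w i * (norm (T i x - x))\<^sup>2) \<le> (weighted_op I T w x - x) \<bullet> (q - x)"
proof -
  have "(\<Sum>i\<in>I. w i * (norm (T i x - x))\<^sup>2) \<le> (\<Sum>i\<in>I. w i * ((T i x - x) \<bullet> (q - x)))"
  proof (intro sum_mono mult_left_mono)
    fix i assume i: "i \<in> I"
    show "(norm (T i x - x))\<^sup>2 \<le> (T i x - x) \<bullet> (q - x)"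
      using cutter_displacement_bound assms i by blast
    show "0 \<le> w i"
      using assms(1) i by (auto simp: weight_function_def)
  qed
  also have "\<dots> = (weighted_op I T w x - x) \<bullet> (q - x)"
    by (simp add: weighted_op_displacement[OF assms(1)] inner_sum_left)
  finally show ?thesis .
qed

lemma weighted_op_fixed_point:
  assumes "finite I" and "weight_function I w"
    and "\<And>i. i \<in> I \<Longrightarrow> cutter (T i)" and "(\<Inter>i\<in>I. Fix (T i)) \<noteq> {}"
    and "weighted_op I T w x = x" and "i \<in> active_indices I w"
  shows "T i x = x"
proof -
  let ?f = "\<lambda>i. w i * (norm (T i x - x))\<^sup>2"
  obtain q where q: "q \<in> (\<Inter>i\<in>I. Fix (T i))"
    using assms(4) by blast
  have "sum ?f I \<le> 0"
    using weighted_op_displacement_bound[of I w T q x] assms q by simp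
  moreover have nonneg: "0 \<le> ?f j" if "j \<in> I" for j
    using assms(2) that by (fastforce simp: weight_function_def intro!: mult_nonneg_nonneg)
  ultimately have "sum ?f I = 0"
    by (simp add: order.antisym sum_nonneg)
  then have "\<forall>j\<in>I. ?f j = 0"
    using sum_nonneg_eq_0_iff[OF assms(1), of ?f] nonneg by blast
  then show ?thesis
    using assms(6) by (auto simp: active_indices_def)
qed

theorem corollary3p9:
  fixes T :: "nat \<Rightarrow> 'a \<Rightarrow> 'a::{real_inner,complete_space}"
    and m :: nat and w :: "nat \<Rightarrow> real" and \<tau>\<^sub>1 \<tau>\<^sub>2 lam :: real and x :: 'a
  assumes "\<And>i. i \<in> {1..m} \<Longrightarrow> cutter (T i)"
    and "(\<Inter>i\<in>{1..m}. Fix (T i)) \<noteq> {}"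
    and "\<tau>\<^sub>1 \<in> {0<..1}" and "\<tau>\<^sub>2 \<in> {0<..1}"
    and "weight_function {1..m} w"
    and "lam \<in> {\<tau>\<^sub>1..(2 - \<tau>\<^sub>2) * extrapolation {1..m} T x w}"
    and "relaxed_op {1..m} T w lam x = x"
  shows "\<forall>i\<in>active_indices {1..m} w. T i x = x"
proof
  fix i assume "i \<in> active_indices {1..m} w"
  moreover have "lam \<noteq> 0"
    using assms(3,6) by auto
  then have "weighted_op {1..m} T w x = x"
    using assms(7) by (simp add: relaxed_op_def)
  ultimately show "T i x = x"
    using weighted_op_fixed_point[of "{1..m}" w T x i] assms(1,2,5) by blast
qed

end
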